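(* Let $X$ be a $k$-valent graph, let $G\le \mathrm{Aut}(X)$ be such that $X$ is $G$-dart-transitive, and let $M$ be a $G$-invariant separating relation for $X$ such that each $M$-equivalence class has cardinality $d$. Let $\Gamma=\mathrm{BGCG}(X,M)$, with $G$ acting on $\Gamma$ in the natural way (a black vertex of $\Gamma$ is a vertex $x$ of $X$ and is mapped by $g\in G$ to $x^g$; a white vertex of $\Gamma$ is an $M$-class of edges of $X$ and is mapped by $g$ to its image under $g$). Then $\Gamma$ is a simple $G$-bi-transitive $2$-colored graph with black vertices having valency $k$ and white vertices having valency $2d$. Moreover, for every white vertex $v$ of $\Gamma$, the group $G_v^{\Gamma(v)}$ is imprimitive.
   Context: Graphs. A graph is a triple $(V,E,\partial)$ with $V$ (vertices) and $E$ (edges) finite sets and $\partial$ a map from $E$ to the set of $2$-element subsets of $V$; the elements of $\partial(e)$ are the endvertices of $e$. Parallel edges ($\partial(e_1)=\partial(e_2)$) are allowed; the graph is simple if $\partial$ is injective. Two edges are adjacent if they share an endvertex. The neighbourhood $\Gamma(v)$ of a vertex $v$ is the set of edges having $v$ as an endvertex, and the valency of $v$ is $|\Gamma(v)|$; a graph is $k$-valent if all vertices have valency $k$. A dart is a pair $(e,v)$ with $e$ an edge and $v\in\partial(e)$. Symmetries. A symmetry of a graph is a permutation $g$ of $V\cup E$ preserving $V$ and $E$ with $\partial(e^g)=\partial(e)^g$ for all edges $e$; the symmetries form the group $\mathrm{Aut}$ (acting on the right). For a group $G$ of symmetries, the graph is $G$-dart-transitive (resp. $G$-edge-transitive) if $G$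 is transitive on darts (resp. edges). A $2$-colored graph is a graph with a proper coloring of its vertices in black and white. A $2$-colored graph is $G$-bi-transitive if $G$ is a group of color-preserving symmetries that is transitive on edges. $G_v$ is the stabilizer of the vertex $v$ in $G$, and $G_v^{\Gamma(v)}$ is the permutation group induced by $G_v$ on $\Gamma(v)$. Separating relation. A separating relation for a graph $X$ is an equivalence relation $M$ on the edge set of $X$ such that no two (distinct) adjacent edges of $X$ are $M$-related. BGCG. Given a graph $X$ and a separating relation $M$ for $X$, let $X^*$ be the subdivision of $X$: vertices of $X$ are black, each edge $e$ of $X$ is replaced by a new white vertex joined by one new edge to each of the two endvertices of $e$. Regard $M$ as an equivalence relation on the white vertices of $X^*$ (identified with the edges of $X$), and extend it to all vertices of $X^*$ by making each black vertex related only to itself. Then $\mathrm{BGCG}(X,M)$ is the quotient $X^*/M$: its vertices are the classes $[u]$, and each edge $e$ of $X^*$ with ends $u,v$ gives an edge $[e]$ with ends $[u],[v]$. It inherits the black/white coloring of $X^*$.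
   Formalization: Imprimitivity of the group induced at a white vertex is claimed only for d ≥ 2; for d = 1 it is false (X = K_2, G = Aut(X), M equality: white vertices have valency 2 and a transitive group on 2 points is primitive). *)

theory Defs
  imports "HOL-Algebra.Group" "HOL-Combinatorics.Permutations" "HOL-Library.Disjoint_Sets"
begin

section \<open>Graphs\<close>

record ('v, 'e) multigraph =
  verts :: "'v set"
  edges :: "'e set"
  ends :: "'e \<Rightarrow> 'v set"

definition is_graph :: "('v, 'e) multigraph \<Rightarrow> bool" where
  "is_graph X \<longleftrightarrow> finite (verts X) \<and> finite (edges X) \<and>
     (\<forall>e\<in>edges X. ends X e \<subseteq> verts X \<and> card (ends X e) = 2)"

definition simple_graph :: "('v, 'e) multigraph \<Rightarrow> bool" where
  "simple_graph X \<longleftrightarrow> is_graph X \<and> inj_on (ends X) (edges X)"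

definition nbhd :: "('v, 'e) multigraph \<Rightarrow> 'v \<Rightarrow> 'e set" where
  "nbhd X v = {e \<in> edges X. v \<in> ends X e}"

definition valency :: "('v, 'e) multigraph \<Rightarrow> 'v \<Rightarrow> nat" where
  "valency X v = card (nbhd X v)"

definition valent :: "nat \<Rightarrow> ('v, 'e) multigraph \<Rightarrow> bool" where
  "valent k X \<longleftrightarrow> (\<forall>v\<in>verts X. valency X v = k)"

definition adjacent_edges :: "('v, 'e) multigraph \<Rightarrow> 'e \<Rightarrow> 'e \<Rightarrow> bool" where
  "adjacent_edges X e f \<longleftrightarrow> ends X e \<inter> ends X f \<noteq> {}"

definition darts :: "('v, 'e) multigraph \<Rightarrow> ('e \<times> 'v) set" where
  "darts X = {(e, v). e \<in> edges X \<and> v \<in> ends X e}"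


section \<open>Symmetries\<close>

text \<open>A symmetry permutes the disjoint union of vertices and edges, which is rendered as a
  subset of the sum type; it is the identity outside that set. The next two functions are its
  actions on vertices and on edges; they are only meaningful on vertices and edges of the graph
  for functions that preserve the two parts.\<close>

definition vact :: "('v + 'e \<Rightarrow> 'v + 'e) \<Rightarrow> 'v \<Rightarrow> 'v" where
  "vact g v = projl (g (Inl v))"

definition eact :: "('v + 'e \<Rightarrow> 'v + 'e) \<Rightarrow> 'e \<Rightarrow> 'e" where
  "eact g e = projr (g (Inr e))"

definition symmetry :: "('v, 'e) multigraph \<Rightarrow> ('v + 'e \<Rightarrow> 'v + 'e) \<Rightarrow> bool" where
  "symmetry X g \<longleftrightarrow>
     g permutes (verts X <+> edges X) \<and>
     g ` Inl ` verts X = Inl ` verts X \<and>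
     g ` Inr ` edges X = Inr ` edges X \<and>
     (\<forall>e\<in>edges X. ends X (eact g e) = vact g ` ends X e)"

text \<open>Symmetries act on the right: the product of \<open>g\<close> and \<open>h\<close> applies \<open>g\<close> first.\<close>

definition Aut :: "('v, 'e) multigraph \<Rightarrow> ('v + 'e \<Rightarrow> 'v + 'e) monoid" where
  "Aut X = \<lparr>carrier = {g. symmetry X g}, monoid.mult = (\<lambda>g h. h \<circ> g), one = id\<rparr>"

definition dart_transitive ::
    "('v, 'e) multigraph \<Rightarrow> ('v + 'e \<Rightarrow> 'v + 'e) set \<Rightarrow> bool" where
  "dart_transitive X G \<longleftrightarrow> subgroup G (Aut X) \<and>
     (\<forall>(e, v)\<in>darts X. \<forall>(f, w)\<in>darts X. \<exists>g\<in>G. eact g e = f \<and> vact g v = w)"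

definition edge_transitive ::
    "('v, 'e) multigraph \<Rightarrow> ('v + 'e \<Rightarrow> 'v + 'e) set \<Rightarrow> bool" where
  "edge_transitive X G \<longleftrightarrow> subgroup G (Aut X) \<and>
     (\<forall>e\<in>edges X. \<forall>f\<in>edges X. \<exists>g\<in>G. eact g e = f)"

datatype color = Black | White

definition two_colored :: "('v, 'e) multigraph \<Rightarrow> ('v \<Rightarrow> color) \<Rightarrow> bool" where
  "two_colored X c \<longleftrightarrow> is_graph X \<and> (\<forall>e\<in>edges X. inj_on c (ends X e))"

definition bi_transitive ::
    "('v, 'e) multigraph \<Rightarrow> ('v \<Rightarrow> color) \<Rightarrow> ('v + 'e \<Rightarrow> 'v + 'e) set \<Rightarrow> bool" where
  "bi_transitive X c G \<longleftrightarrow> two_colored X c \<and> edge_transitive X G \<and>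
     (\<forall>g\<in>G. \<forall>v\<in>verts X. c (vact g v) = c v)"

definition vstab :: "('v + 'e \<Rightarrow> 'v + 'e) set \<Rightarrow> 'v \<Rightarrow> ('v + 'e \<Rightarrow> 'v + 'e) set" where
  "vstab G v = {g \<in> G. vact g v = v}"

text \<open>The permutation group induced on the neighbourhood of \<open>v\<close> by the stabilizer of \<open>v\<close>; its
  elements are permutations in the sense of \<^const>\<open>permutes\<close>, hence the identity elsewhere.\<close>

definition local_group ::
    "('v, 'e) multigraph \<Rightarrow> ('v + 'e \<Rightarrow> 'v + 'e) set \<Rightarrow> 'v \<Rightarrow> ('e \<Rightarrow> 'e) set" where
  "local_group X G v =
     (\<lambda>g e. if e \<in> nbhd X v then eact g e else e) ` vstab G v"

text \<open>A permutation group \<open>P\<close> on \<open>S\<close> is imprimitive if it is transitive and preserves a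
  partition of \<open>S\<close> other than the two trivial ones. In particular no group on a set with
  at most two points is imprimitive.\<close>

definition imprimitive :: "'a set \<Rightarrow> ('a \<Rightarrow> 'a) set \<Rightarrow> bool" where
  "imprimitive S P \<longleftrightarrow>
     (\<forall>x\<in>S. \<forall>y\<in>S. \<exists>p\<in>P. p x = y) \<and>
     (\<exists>\<B>. partition_on S \<B> \<and> \<B> \<noteq> {S} \<and> \<B> \<noteq> (\<lambda>x. {x}) ` S \<and>
          (\<forall>p\<in>P. \<forall>B\<in>\<B>. p ` B \<in> \<B>))"


section \<open>The BGCG construction\<close>

definition separating :: "('v, 'e) multigraph \<Rightarrow> ('e \<times> 'e) set \<Rightarrow> bool" where
  "separating X M \<longleftrightarrow> equiv (edges X) M \<and>
     (\<forall>e f. (e, f) \<in> M \<longrightarrow> e \<noteq> f \<longrightarrow> \<not> adjacent_edges X e f)"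

definition invariant_rel :: "('v + 'e \<Rightarrow> 'v + 'e) set \<Rightarrow> ('e \<times> 'e) set \<Rightarrow> bool" where
  "invariant_rel G M \<longleftrightarrow> (\<forall>g\<in>G. \<forall>(e, f)\<in>M. (eact g e, eact g f) \<in> M)"

text \<open>In the subdivision, \<open>Inl x\<close> is the black vertex \<open>x\<close> and \<open>Inr e\<close> is the white vertex
  replacing the edge \<open>e\<close>. The new edge joining them is named by the dart \<open>(e, x)\<close>.\<close>

definition subdivision :: "('v, 'e) multigraph \<Rightarrow> ('v + 'e, 'e \<times> 'v) multigraph" where
  "subdivision X =
     \<lparr>verts = verts X <+> edges X, edges = darts X, ends = (\<lambda>(e, x). {Inl x, Inr e})\<rparr>"

text \<open>Different edges remain different in the quotient, possibly becoming parallel; the edge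
  \<open>[e]\<close> keeps the name \<open>e\<close>.\<close>

definition quotient_graph ::
    "('v, 'e) multigraph \<Rightarrow> ('v \<times> 'v) set \<Rightarrow> ('v set, 'e) multigraph" where
  "quotient_graph X R =
     \<lparr>verts = verts X // R, edges = edges X, ends = (\<lambda>e. (\<lambda>u. R `` {u}) ` ends X e)\<rparr>"

definition extend_rel ::
    "('v, 'e) multigraph \<Rightarrow> ('e \<times> 'e) set \<Rightarrow> (('v + 'e) \<times> ('v + 'e)) set" where
  "extend_rel X M = {(Inl x, Inl x) | x. x \<in> verts X} \<union> {(Inr e, Inr f) | e f. (e, f) \<in> M}"

definition BGCG ::
    "('v, 'e) multigraph \<Rightarrow> ('e \<times> 'e) set \<Rightarrow> (('v + 'e) set, 'e \<times> 'v) multigraph" where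
  "BGCG X M = quotient_graph (subdivision X) (extend_rel X M)"

definition bgcg_color :: "('v + 'e) set \<Rightarrow> color" where
  "bgcg_color C = (if \<exists>x. Inl x \<in> C then Black else White)"

text \<open>The natural action of a symmetry \<open>g\<close> of \<open>X\<close>. The vertices of the subdivision are the
  vertices and edges of \<open>X\<close>, so \<open>g\<close> itself acts on them, and a vertex of the quotient is mapped
  to its image under \<open>g\<close>.\<close>

definition bgcg_act ::
    "('v, 'e) multigraph \<Rightarrow> ('e \<times> 'e) set \<Rightarrow> ('v + 'e \<Rightarrow> 'v + 'e) \<Rightarrow>
      (('v + 'e) set + 'e \<times> 'v \<Rightarrow> ('v + 'e) set + 'e \<times> 'v)" where
  "bgcg_act X M g u =
     (case u of
        Inl C \<Rightarrow> Inl (if C \<in> verts (BGCG X M) then g ` C else C)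
      | Inr (e, x) \<Rightarrow>
          Inr (if (e, x) \<in> edges (BGCG X M) then (eact g e, vact g x) else (e, x)))"

end

theory Submission
  imports Defs
begin

text \<open>Invariance of the relation \<open>M\<close> makes \<open>G\<close> act on its classes, hence on the quotient of the
  subdivision. The edges of the quotient are the darts of \<open>X\<close>, so dart-transitivity becomes
  edge-transitivity. Two parallel edges of the quotient would be darts \<open>(e, x)\<close>, \<open>(f, x)\<close> with
  \<open>e\<close> and \<open>f\<close> related and adjacent, so \<open>e = f\<close> because \<open>M\<close> is separating. The darts at a
  white vertex, that is at a class of \<open>d\<close> edges, fall into the \<open>d\<close> pairs of darts with the same
  edge of \<open>X\<close>; these pairs are the blocks of imprimitivity.\<close>

section \<open>The group of symmetries\<close>

lemma symmetry_Inl: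
  assumes "symmetry X g" "v \<in> verts X"
  shows "g (Inl v) = Inl (vact g v)" and "vact g v \<in> verts X"
proof -
  have "g (Inl v) \<in> g ` Inl ` verts X"
    using assms(2) by simp
  then have "g (Inl v) \<in> Inl ` verts X"
    using assms(1) by (simp add: symmetry_def)
  then show "g (Inl v) = Inl (vact g v)" "vact g v \<in> verts X"
    by (auto simp: vact_def)
qed

lemma symmetry_Inr:
  assumes "symmetry X g" "e \<in> edges X"
  shows "g (Inr e) = Inr (eact g e)" and "eact g e \<in> edges X"
proof -
  have "g (Inr e) \<in> g ` Inr ` edges X"
    using assms(2) by simp
  then have "g (Inr e) \<in> Inr ` edges X"
    using assms(1) by (simp add: symmetry_def)
  then show "g (Inr e) = Inr (eact g e)" "eact g e \<in> edges X"
    by (auto simp: eact_def)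
qed

lemma symmetry_ends: "symmetry X g \<Longrightarrow> e \<in> edges X \<Longrightarrow> ends X (eact g e) = vact g ` ends X e"
  by (simp add: symmetry_def)

text \<open>Checking that each part is mapped into itself suffices: \<open>g\<close> is onto the
  disjoint union, and the preimage of a vertex cannot be an edge because edges go to edges. The same
  holds with the roles exchanged.\<close>

lemma symmetryI:
  assumes g: "g permutes (verts X <+> edges X)"
    and v: "\<And>v. v \<in> verts X \<Longrightarrow> g (Inl v) \<in> Inl ` verts X"
    and e: "\<And>e. e \<in> edges X \<Longrightarrow> g (Inr e) \<in> Inr ` edges X"
    and ends: "\<And>e. e \<in> edges X \<Longrightarrow> ends X (eact g e) = vact g ` ends X e"
  shows "symmetry X g"
proof -
  have surj: "g ` (Inl ` verts X \<union> Inr ` edges X) = Inl ` verts X \<union> Inr ` edges X"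
    using permutes_image[OF g] by (simp add: Plus_def)
  have "Inl ` verts X \<subseteq> g ` Inl ` verts X"
  proof
    fix y :: "'a + 'b" assume y: "y \<in> Inl ` verts X"
    then have "y \<in> g ` (Inl ` verts X \<union> Inr ` edges X)"
      by (simp add: surj)
    then obtain x where x: "y = g x" "x \<in> Inl ` verts X \<union> Inr ` edges X"
      by (rule imageE)
    show "y \<in> g ` Inl ` verts X"
      using x(2)
    proof
      assume "x \<in> Inr ` edges X"
      then have "y \<in> Inr ` edges X" using e x(1) by (elim imageE) simp
      then show ?thesis using y by auto
    qed (simp add: x(1))
  qed
  moreover have "Inr ` edges X \<subseteq> g ` Inr ` edges X"
  proof
    fix y :: "'a + 'b" assume y: "y \<in> Inr ` edges X"
    then have "y \<in> g ` (Inl ` verts X \<union> Inr ` edges X)"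
      by (simp add: surj)
    then obtain x where x: "y = g x" "x \<in> Inl ` verts X \<union> Inr ` edges X"
      by (rule imageE)
    show "y \<in> g ` Inr ` edges X"
      using x(2)
    proof
      assume "x \<in> Inl ` verts X"
      then have "y \<in> Inl ` verts X" using v x(1) by (elim imageE) simp
      then show ?thesis using y by auto
    qed (simp add: x(1))
  qed
  moreover have "g ` Inl ` verts X \<subseteq> Inl ` verts X"
    using v by (simp add: image_subset_iff)
  moreover have "g ` Inr ` edges X \<subseteq> Inr ` edges X"
    using e by (simp add: image_subset_iff)
  ultimately have "g ` Inl ` verts X = Inl ` verts X \<and> g ` Inr ` edges X = Inr ` edges X"
    by (intro conjI subset_antisym)
  then show ?thesis
    unfolding symmetry_def using g ends by simp
qed

lemma is_graph_ends: "is_graph X \<Longrightarrow> e \<in> edges X \<Longrightarrow> x \<in> ends X e \<Longrightarrow> x \<in> verts X"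
  by (auto simp: is_graph_def)

lemma vact_comp: "symmetry X g \<Longrightarrow> v \<in> verts X \<Longrightarrow> vact (h \<circ> g) v = vact h (vact g v)"
  using symmetry_Inl(1)[of X g v] by (simp add: vact_def)

lemma eact_comp: "symmetry X g \<Longrightarrow> e \<in> edges X \<Longrightarrow> eact (h \<circ> g) e = eact h (eact g e)"
  using symmetry_Inr(1)[of X g e] by (simp add: eact_def)

lemma vact_id [simp]: "vact id v = v"
  by (simp add: vact_def)

lemma eact_id [simp]: "eact id e = e"
  by (simp add: eact_def)

lemma symmetry_id: "symmetry X id"
  by (auto simp: symmetry_def permutes_id)

lemma symmetry_comp:
  assumes X: "is_graph X" and g: "symmetry X g" and h: "symmetry X h"
  shows "symmetry X (h \<circ> g)"
proof (rule symmetryI)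
  show "h \<circ> g permutes (verts X <+> edges X)"
    using g h by (auto simp: symmetry_def intro: permutes_compose)
next
  fix e assume e: "e \<in> edges X"
  have "ends X (eact (h \<circ> g) e) = vact h ` vact g ` ends X e"
    using e g h by (simp add: eact_comp symmetry_ends symmetry_Inr)
  also have "\<dots> = vact (h \<circ> g) ` ends X e"
    unfolding image_image
    by (intro image_cong refl) (use X e g in \<open>auto simp: vact_comp dest: is_graph_ends\<close>)
  finally show "ends X (eact (h \<circ> g) e) = vact (h \<circ> g) ` ends X e" .
qed (use g h in \<open>auto simp: symmetry_Inl symmetry_Inr\<close>)

text \<open>\<open>g\<close> maps each part onto itself, hence so does its inverse. For the ends of
  \<open>f\<close>, write \<open>f\<close> as the image of an edge \<open>f'\<close> under
  \<open>g\<close>: the ends of \<open>f\<close> are the images of those of \<open>f'\<close>, and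
  on these the inverse cancels \<open>g\<close>.\<close>

lemma symmetry_inv:
  assumes X: "is_graph X" and g: "symmetry X g"
  shows "symmetry X (inv_into UNIV g)"
proof -
  have perm: "g permutes (verts X <+> edges X)"
    using g by (simp add: symmetry_def)
  note i = permutes_inverses[OF perm]
  have v: "inv_into UNIV g (Inl v) \<in> Inl ` verts X" if "v \<in> verts X" for v
  proof -
    have "Inl v \<in> g ` Inl ` verts X"
      using that g by (simp add: symmetry_def)
    then show ?thesis using i(2) by auto
  qed
  have e: "inv_into UNIV g (Inr e) \<in> Inr ` edges X" if "e \<in> edges X" for e
  proof -
    have "Inr e \<in> g ` Inr ` edges X"
      using that g by (simp add: symmetry_def)
    then show ?thesis using i(2) by auto
  qed
  show ?thesis
  proof (rule symmetryI)
    show "inv_into UNIV g permutes (verts X <+> edges X)"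
      using perm by (rule permutes_inv)
  next
    fix f assume f: "f \<in> edges X"
    obtain f' where f': "f' \<in> edges X" "inv_into UNIV g (Inr f) = Inr f'"
      using e[OF f] by blast
    have "g (Inr f') = Inr f"
      using f'(2) i(1) by metis
    then have gf: "eact g f' = f" and if': "eact (inv_into UNIV g) f = f'"
      using f' by (simp_all add: eact_def)
    have "vact (inv_into UNIV g) ` ends X f = (\<lambda>x. vact (inv_into UNIV g) (vact g x)) ` ends X f'"
      using symmetry_ends[OF g f'(1)] gf by (simp add: image_image)
    also have "\<dots> = (\<lambda>x. x) ` ends X f'"
    proof (intro image_cong refl)
      fix x assume "x \<in> ends X f'"
      then have "x \<in> verts X" using X f'(1) by (blast dest: is_graph_ends)
      then have "vact (inv_into UNIV g) (vact g x) = vact (inv_into UNIV g \<circ> g) x"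
        using g by (simp add: vact_comp)
      then show "vact (inv_into UNIV g) (vact g x) = x"
        using permutes_inv_o(2)[OF perm] by simp
    qed
    finally show "ends X (eact (inv_into UNIV g) f) = vact (inv_into UNIV g) ` ends X f"
      by (simp add: if')
  qed (use v e in auto)
qed

lemma symmetry_inv_comp:
  assumes "symmetry X g"
  shows "inv_into UNIV g \<circ> g = id" and "g \<circ> inv_into UNIV g = id"
  using assms permutes_inv_o[of g] by (auto simp: symmetry_def)

lemma group_Aut:
  assumes "is_graph X"
  shows "group (Aut X)"
proof (rule groupI)
  fix g assume "g \<in> carrier (Aut X)"
  \<comment> \<open>With the product in right-action order, this left inverse law reads
    \<open>g \<circ> h = id\<close>.\<close>
  then show "\<exists>h\<in>carrier (Aut X). h \<otimes>\<^bsub>Aut X\<^esub> g = \<one>\<^bsub>Aut X\<^esub>"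
    using assms by (intro bexI[of _ "inv_into UNIV g"])
      (auto simp: Aut_def symmetry_inv symmetry_inv_comp)
qed (use assms in \<open>auto simp: Aut_def symmetry_comp symmetry_id comp_assoc\<close>)

text \<open>Turns closure of a subgroup under the abstract group inverse into closure under
  functional inversion.\<close>

lemma inv_Aut:
  assumes "is_graph X" "symmetry X g"
  shows "inv\<^bsub>Aut X\<^esub> g = inv_into UNIV g"
proof -
  interpret group "Aut X" using assms(1) by (rule group_Aut)
  show ?thesis
    using assms by (intro inv_equality) (auto simp: Aut_def symmetry_inv symmetry_inv_comp)
qed

section \<open>The structure of the quotient\<close>

lemma edges_BGCG [simp]: "edges (BGCG X M) = darts X"
  by (simp add: BGCG_def quotient_graph_def subdivision_def)

lemma extend_rel_Inl: "x \<in> verts X \<Longrightarrow> extend_rel X M `` {Inl x} = {Inl x}"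
  by (auto simp: extend_rel_def)

lemma extend_rel_Inr: "extend_rel X M `` {Inr e} = Inr ` (M `` {e})"
  by (auto simp: extend_rel_def)

text \<open>Gives every class an explicit shape, so that a vertex of known color can be replaced by
  \<open>{Inl x}\<close> or by the tagged class of an edge.\<close>

lemma verts_BGCG:
  "verts (BGCG X M) = (\<lambda>x. {Inl x}) ` verts X \<union> (\<lambda>e. Inr ` (M `` {e})) ` edges X"
proof -
  have "verts (BGCG X M) = (\<lambda>u. extend_rel X M `` {u}) ` (Inl ` verts X \<union> Inr ` edges X)"
    by (auto simp: BGCG_def quotient_graph_def subdivision_def quotient_def Plus_def)
  then show ?thesis
    by (simp add: image_Un image_image extend_rel_Inl extend_rel_Inr cong: image_cong)
qed

lemma ends_BGCG:
  assumes "is_graph X" "(e, x) \<in> darts X"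
  shows "ends (BGCG X M) (e, x) = {{Inl x}, Inr ` (M `` {e})}"
proof -
  \<comment> \<open>\<open>extend_rel\<close> is reflexive at \<open>Inl x\<close> only for vertices
    \<open>x\<close> of \<open>X\<close>; for any other \<open>x\<close> the class of
    \<open>Inl x\<close> would be empty.\<close>
  have "x \<in> verts X"
    using assms by (auto simp: darts_def is_graph_ends)
  then show ?thesis
    by (simp add: BGCG_def quotient_graph_def subdivision_def extend_rel_Inl extend_rel_Inr)
qed

lemma bgcg_color_simps [simp]:
  "bgcg_color {Inl x} = Black" "bgcg_color (Inr ` A) = White"
  by (auto simp: bgcg_color_def)

text \<open>Applied to an \<open>M\<close>-class, this count yields the valency of a white
  vertex.\<close>

lemma card_darts_over:
  assumes "is_graph X" "A \<subseteq> edges X"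
  shows "card (Sigma A (ends X)) = 2 * card A"
proof -
  have "finite A"
    using assms finite_subset by (auto simp: is_graph_def)
  moreover have "\<forall>e\<in>A. finite (ends X e) \<and> card (ends X e) = 2"
    using assms by (auto simp: is_graph_def subset_eq intro!: card_ge_0_finite)
  ultimately show ?thesis
    by (simp add: card_SigmaI)
qed

section \<open>The induced action of \<open>G\<close> on classes and darts\<close>

locale bgcg =
  fixes X :: "('v, 'e) multigraph"
    and G :: "('v + 'e \<Rightarrow> 'v + 'e) set"
    and M :: "('e \<times> 'e) set"
  assumes graph: "is_graph X"
    and G: "subgroup G (Aut X)"
    and sep: "separating X M"
    and inv_rel: "invariant_rel G M"
begin

abbreviation "\<Gamma> \<equiv> BGCG X M"
abbreviation "act \<equiv> bgcg_act X M"

lemma equiv: "equiv (edges X) M"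
  using sep by (simp add: separating_def)

lemma symm: "g \<in> G \<Longrightarrow> symmetry X g"
  using subgroup.subset[OF G] by (auto simp: Aut_def)

lemma id_in: "id \<in> G"
  using subgroup.one_closed[OF G] by (simp add: Aut_def)

lemma comp_in: "g \<in> G \<Longrightarrow> h \<in> G \<Longrightarrow> h \<circ> g \<in> G"
  using subgroup.m_closed[OF G] by (simp add: Aut_def)

lemma inv_in: "g \<in> G \<Longrightarrow> inv_into UNIV g \<in> G"
  using subgroup.m_inv_closed[OF G] inv_Aut[OF graph symm] by simp

lemma class_subset: "M `` {e} \<subseteq> edges X"
  using equiv by (auto simp: equiv_def)

lemma dart_edge: "(e, x) \<in> darts X \<Longrightarrow> e \<in> edges X"
  and dart_vert: "(e, x) \<in> darts X \<Longrightarrow> x \<in> verts X"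
  using graph by (auto simp: darts_def is_graph_ends)

text \<open>\<open>invariant_rel\<close> is the implication from right to left; the converse applies
  it to the inverse of \<open>g\<close>, which lies in \<open>G\<close>.\<close>

lemma eact_related_iff:
  assumes g: "g \<in> G" and "e \<in> edges X" "f \<in> edges X"
  shows "(eact g e, eact g f) \<in> M \<longleftrightarrow> (e, f) \<in> M"
proof
  assume "(eact g e, eact g f) \<in> M"
  then have "(eact (inv_into UNIV g) (eact g e), eact (inv_into UNIV g) (eact g f)) \<in> M"
    using inv_rel inv_in[OF g] by (auto simp: invariant_rel_def)
  moreover have "eact (inv_into UNIV g) (eact g a) = a" if "a \<in> edges X" for a
    using eact_comp[OF symm[OF g] that, of "inv_into UNIV g"]
      symmetry_inv_comp[OF symm[OF g]] by simp
  ultimately show "(e, f) \<in> M"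
    using assms by simp
qed (use inv_rel g in \<open>auto simp: invariant_rel_def\<close>)

text \<open>Invariance gives one inclusion. For the other, a member of the target class is the image
  of some edge, since \<open>g\<close> permutes the edges, and that edge is related to
  \<open>e\<close> because \<open>g\<close> also reflects \<open>M\<close>.\<close>

lemma image_class:
  assumes g: "g \<in> G" and e: "e \<in> edges X"
  shows "g ` Inr ` (M `` {e}) = Inr ` (M `` {eact g e})"
proof -
  have "eact g ` (M `` {e}) = M `` {eact g e}"
  proof
    show "eact g ` (M `` {e}) \<subseteq> M `` {eact g e}"
      using inv_rel g by (auto simp: invariant_rel_def)
    show "M `` {eact g e} \<subseteq> eact g ` (M `` {e})"
    proof
      fix f assume f: "f \<in> M `` {eact g e}"
      then have "f \<in> edges X" using class_subset by blast
      then have "Inr f \<in> g ` Inr ` edges X"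
        using symm[OF g] by (simp add: symmetry_def)
      then obtain f' where f': "f' \<in> edges X" "eact g f' = f"
        using symmetry_Inr(1)[OF symm[OF g]] by auto
      then have "(e, f') \<in> M"
        using f eact_related_iff[OF g e f'(1)] by simp
      then show "f \<in> eact g ` (M `` {e})"
        using f'(2) by blast
    qed
  qed
  moreover have "g ` Inr ` (M `` {e}) = Inr ` eact g ` (M `` {e})"
    unfolding image_image
    by (intro image_cong refl) (meson class_subset symmetry_Inr(1)[OF symm[OF g]] subsetD)
  ultimately show ?thesis by simp
qed

lemma image_vertex:
  assumes g: "g \<in> G" and "C \<in> verts \<Gamma>"
  shows "g ` C \<in> verts \<Gamma>" and "bgcg_color (g ` C) = bgcg_color C"
  using assms symmetry_Inl[OF symm[OF g]] symmetry_Inr[OF symm[OF g]] image_class[OF g]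
  by (auto simp: verts_BGCG)

lemma image_dart: "g \<in> G \<Longrightarrow> (e, x) \<in> darts X \<Longrightarrow> (eact g e, vact g x) \<in> darts X"
  using symm[of g] by (auto simp: darts_def symmetry_Inr symmetry_ends)

lemma vact_act: "C \<in> verts \<Gamma> \<Longrightarrow> vact (act g) C = g ` C"
  by (simp add: vact_def bgcg_act_def)

lemma eact_act: "(e, x) \<in> darts X \<Longrightarrow> eact (act g) (e, x) = (eact g e, vact g x)"
  by (simp add: eact_def bgcg_act_def)

lemma act_Inl: "act g (Inl C) = Inl (if C \<in> verts \<Gamma> then g ` C else C)"
  by (simp add: bgcg_act_def)

lemma act_Inr:
  "act g (Inr (e, x)) = Inr (if (e, x) \<in> darts X then (eact g e, vact g x) else (e, x))"
  by (simp add: bgcg_act_def)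

text \<open>\<open>bgcg_act\<close> is the identity off the vertices and edges of the quotient, so
  the law needs \<open>g\<close> to keep vertices among vertices and darts among darts; then both
  sides take the same branch of the definition.\<close>

lemma act_comp:
  assumes g: "g \<in> G"
  shows "act (h \<circ> g) = act h \<circ> act g"
proof
  fix u :: "('v + 'e) set + 'e \<times> 'v"
  show "act (h \<circ> g) u = (act h \<circ> act g) u"
  proof (cases u)
    case (Inl C)
    then show ?thesis using image_vertex(1)[OF g] by (simp add: act_Inl image_comp)
  next
    case (Inr a)
    obtain e x where "a = (e, x)" by (cases a)
    then show ?thesis
      using Inr image_dart[OF g] symm[OF g]
      by (auto simp: act_Inr vact_comp eact_comp dart_edge dart_vert)
  qed
qed

lemma act_id: "act id = id"
proof
  fix u :: "('v + 'e) set + 'e \<times> 'v"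
  show "act id u = id u"
    by (cases u) (auto simp: act_Inl act_Inr split: prod.splits)
qed

lemma is_graph_BGCG: "is_graph \<Gamma>"
  unfolding is_graph_def
proof (intro conjI ballI)
  show "finite (verts \<Gamma>)"
    using graph by (simp add: verts_BGCG is_graph_def)
  have "darts X \<subseteq> edges X \<times> verts X"
    using dart_edge dart_vert by auto
  then show "finite (edges \<Gamma>)"
    using graph finite_subset by (fastforce simp: is_graph_def)
next
  fix a assume "a \<in> edges \<Gamma>"
  then obtain e x where a: "a = (e, x)" "(e, x) \<in> darts X" by (cases a) simp
  show "ends \<Gamma> a \<subseteq> verts \<Gamma>"
    using a dart_edge dart_vert by (auto simp: ends_BGCG[OF graph] verts_BGCG)
  have "{Inl x} \<noteq> Inr ` (M `` {e})" by blast
  then show "card (ends \<Gamma> a) = 2"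
    using a by (simp add: ends_BGCG[OF graph])
qed

lemma symmetry_act:
  assumes g: "g \<in> G"
  shows "symmetry \<Gamma> (act g)"
proof (rule symmetryI)
  \<comment> \<open>Bijectivity comes without any computation on classes: the inverse of
    \<open>g\<close> lies in \<open>G\<close>, and its action is a two-sided inverse by
    \<open>act_comp\<close> and \<open>act_id\<close>.\<close>
  have "act (inv_into UNIV g) \<circ> act g = id" "act g \<circ> act (inv_into UNIV g) = id"
    using g act_comp[of g "inv_into UNIV g"] act_comp[of "inv_into UNIV g" g] act_id inv_in
      symmetry_inv_comp[OF symm[OF g]] by simp_all
  then have "bij (act g)"
    by (simp add: o_bij)
  \<comment> \<open>This is what the default branches of \<open>bgcg_act\<close> are for:
    \<open>permutes\<close> demands the identity outside the set.\<close>
  moreover have "act g u = u" if "u \<notin> verts \<Gamma> <+> edges \<Gamma>" for u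
    using that by (cases u) (auto simp: act_Inl act_Inr split: if_splits)
  ultimately show "act g permutes (verts \<Gamma> <+> edges \<Gamma>)"
    unfolding permutes_def bij_iff by blast
next
  fix a assume "a \<in> edges \<Gamma>"
  then obtain e x where a: "a = (e, x)" "(e, x) \<in> darts X" by (cases a) simp
  have "vact (act g) ` ends \<Gamma> a = (\<lambda>C. g ` C) ` ends \<Gamma> a"
    using is_graph_BGCG \<open>a \<in> edges \<Gamma>\<close>
    by (intro image_cong refl) (auto simp: vact_act dest: is_graph_ends)
  then show "ends \<Gamma> (eact (act g) a) = vact (act g) ` ends \<Gamma> a"
    using a g dart_edge dart_vert image_dart[OF g]
    by (simp add: eact_act ends_BGCG[OF graph] image_class symmetry_Inl(1)[OF symm[OF g]])
qed (use g in \<open>auto simp: act_Inl act_Inr image_vertex image_dart\<close>)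

text \<open>Both groups multiply in the same reversed order, so \<open>act_comp\<close> is
  multiplicativity as it stands.\<close>

lemma act_hom: "act \<in> hom ((Aut X)\<lparr>carrier := G\<rparr>) (Aut \<Gamma>)"
  by (auto simp: hom_def Aut_def symmetry_act act_comp)

text \<open>The action on black vertices determines \<open>g\<close> on the vertices of
  \<open>X\<close>. Images of white classes need not determine images of single edges, so these are
  read off from darts instead: every edge has an endvertex, and the image of a dart has the image of
  its edge as first component.\<close>

lemma act_inj: "inj_on act G"
proof
  fix g h assume g: "g \<in> G" and h: "h \<in> G" and eq: "act g = act h"
  note s = symm[OF g] symm[OF h]
  show "g = h"
  proof
    fix u
    consider x where "u = Inl x" "x \<in> verts X" | e where "u = Inr e" "e \<in> edges X"
      | "u \<notin> verts X <+> edges X"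
      by (cases u) auto
    then show "g u = h u"
    proof cases
      case 1
      then have "{Inl x} \<in> verts \<Gamma>" by (simp add: verts_BGCG)
      then have "g ` {Inl x} = h ` {Inl x}" using eq vact_act[of "{Inl x}"] by metis
      then show ?thesis using 1 by simp
    next
      case 2
      then have "ends X e \<noteq> {}" using graph by (force simp: is_graph_def)
      then obtain x where "(e, x) \<in> darts X" using 2 by (auto simp: darts_def)
      then have "eact g e = eact h e" using eq eact_act[of e x] by (metis prod.inject)
      then show ?thesis using 2 s by (simp add: symmetry_Inr)
    next
      case 3
      then show ?thesis using s by (simp add: symmetry_def permutes_def)
    qed
  qed
qed

section \<open>Simplicity, coloring, the acting group and valencies\<close>

lemma simple_BGCG: "simple_graph \<Gamma>"
  unfolding simple_graph_def
proof (intro conjI is_graph_BGCG inj_onI)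
  fix a b assume "a \<in> edges \<Gamma>" "b \<in> edges \<Gamma>" and eq: "ends \<Gamma> a = ends \<Gamma> b"
  then obtain e x f y where ab: "a = (e, x)" "b = (f, y)" "(e, x) \<in> darts X" "(f, y) \<in> darts X"
    by (cases a, cases b) simp
  have "{{Inl x}, Inr ` (M `` {e})} = {{Inl y}, Inr ` (M `` {f})}"
    using eq ab by (simp add: ends_BGCG[OF graph])
  \<comment> \<open>The tags leave only one way to match the two pairs: black end with black end and
    white end with white end.\<close>
  then have xy: "x = y" and "Inr ` (M `` {e}) = (Inr ` (M `` {f}) :: ('v + 'e) set)"
    by (auto simp: doubleton_eq_iff)
  then have "M `` {e} = M `` {f}"
    by (simp add: inj_image_eq_iff)
  then have "(e, f) \<in> M"
    using eq_equiv_class[OF _ equiv dart_edge[OF ab(4)]] by blast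
  moreover have "adjacent_edges X e f"
    using ab xy by (auto simp: adjacent_edges_def darts_def)
  ultimately show "a = b"
    using sep ab xy by (auto simp: separating_def)
qed

lemma two_colored_BGCG: "two_colored \<Gamma> bgcg_color"
  unfolding two_colored_def using is_graph_BGCG by (auto simp: ends_BGCG[OF graph])

text \<open>The image of a group homomorphism is a subgroup; here the source is \<open>G\<close> as
  a group in its own right.\<close>

lemma subgroup_act: "subgroup (act ` G) (Aut \<Gamma>)"
proof -
  have "group_hom ((Aut X)\<lparr>carrier := G\<rparr>) (Aut \<Gamma>) act"
    using act_hom subgroup.subgroup_is_group[OF G group_Aut[OF graph]] group_Aut[OF is_graph_BGCG]
    by (simp add: group_hom_def group_hom_axioms_def)
  from group_hom.img_is_subgroup[OF this] show ?thesis by simp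
qed

lemma nbhd_black: "nbhd \<Gamma> {Inl x} = (\<lambda>e. (e, x)) ` nbhd X x"
proof -
  have "nbhd \<Gamma> {Inl x} = {(e, y) \<in> darts X. {Inl x} \<in> ends \<Gamma> (e, y)}"
    by (auto simp: nbhd_def)
  also have "\<dots> = {(e, y) \<in> darts X. y = x}"
    by (auto simp: ends_BGCG[OF graph])
  also have "\<dots> = (\<lambda>e. (e, x)) ` nbhd X x"
    by (auto simp: darts_def nbhd_def)
  finally show ?thesis .
qed

text \<open>The white end of a dart \<open>(f, x)\<close> is the class of \<open>f\<close>, which
  coincides with the class of \<open>e\<close> exactly when \<open>e\<close> and \<open>f\<close>
  are related.\<close>

lemma nbhd_white:
  assumes e: "e \<in> edges X"
  shows "nbhd \<Gamma> (Inr ` (M `` {e})) = Sigma (M `` {e}) (ends X)"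
proof -
  have "(Inr ` (M `` {e}) :: ('v + 'e) set) = Inr ` (M `` {f}) \<longleftrightarrow> (e, f) \<in> M"
    if "f \<in> edges X" for f
    using eq_equiv_class_iff[OF equiv e that] by (simp add: inj_image_eq_iff)
  then show ?thesis
    using class_subset[of e]
    by (auto simp: nbhd_def ends_BGCG[OF graph] darts_def)
qed

lemma valency_black: "valency \<Gamma> {Inl x} = valency X x"
  by (simp add: valency_def nbhd_black card_image inj_on_def)

lemma valency_white:
  "e \<in> edges X \<Longrightarrow> valency \<Gamma> (Inr ` (M `` {e})) = 2 * card (M `` {e})"
  by (simp add: valency_def nbhd_white card_darts_over[OF graph class_subset])

section \<open>Edge-transitivity, and imprimitivity at white vertices\<close>

lemma edge_transitive_BGCG:
  assumes "dart_transitive X G"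
  shows "edge_transitive \<Gamma> (act ` G)"
  using assms subgroup_act by (fastforce simp: edge_transitive_def dart_transitive_def eact_act)

lemma bi_transitive_BGCG:
  assumes "dart_transitive X G"
  shows "bi_transitive \<Gamma> bgcg_color (act ` G)"
  using edge_transitive_BGCG[OF assms] two_colored_BGCG
  by (auto simp: bi_transitive_def vact_act image_vertex)

text \<open>The lower bound 2 yields at least two blocks; over a class with a single edge, the only
  block would be the whole neighbourhood.\<close>

lemma imprimitive_white:
  assumes dt: "dart_transitive X G" and e: "e \<in> edges X" and card: "card (M `` {e}) \<ge> 2"
  defines "C \<equiv> Inr ` (M `` {e})"
  shows "imprimitive (nbhd \<Gamma> C) (local_group \<Gamma> (act ` G) C)"
  unfolding imprimitive_def
proof (intro conjI ballI)
  have C: "C \<in> verts \<Gamma>"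
    using e by (simp add: C_def verts_BGCG)
  have N: "nbhd \<Gamma> C = Sigma (M `` {e}) (ends X)"
    using nbhd_white[OF e] by (simp add: C_def)
  have C_eq: "Inr ` (M `` {f}) = C" if "(e, f) \<in> M" for f
    using that equiv_class_eq[OF equiv] by (simp add: C_def)
  have ne: "ends X f \<noteq> {}" if "f \<in> edges X" for f
    using that graph by (force simp: is_graph_def)
  {
    fix a b assume ab: "a \<in> nbhd \<Gamma> C" "b \<in> nbhd \<Gamma> C"
    then obtain f x h y where fh: "a = (f, x)" "b = (h, y)" "(e, f) \<in> M" "(e, h) \<in> M"
      "x \<in> ends X f" "y \<in> ends X h"
      by (auto simp: N)
    then have d: "(f, x) \<in> darts X" "(h, y) \<in> darts X"
      using class_subset by (auto simp: darts_def)
    then obtain g where g: "g \<in> G" "eact g f = h" "vact g x = y"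
      using dt by (fastforce simp: dart_transitive_def)
    \<comment> \<open>\<open>g\<close> takes the class of \<open>f\<close> to the class of
      \<open>h\<close>, and both classes are \<open>C\<close>; so the element supplied by
      dart-transitivity already lies in the stabilizer.\<close>
    have "g ` C = C"
      using image_class[OF g(1) dart_edge[OF d(1)]] C_eq[OF fh(3)] C_eq[OF fh(4)] g(2) by simp
    then have "act g \<in> vstab (act ` G) C"
      using g(1) C by (simp add: vstab_def vact_act)
    then show "\<exists>p\<in>local_group \<Gamma> (act ` G) C. p a = b"
      using ab(1) fh g d by (auto simp: local_group_def eact_act intro!: bexI[of _ "act g"])
  }
  \<comment> \<open>One block per edge of the class, consisting of its two darts; \<open>N\<close>
    presents the neighbourhood as the disjoint union of these blocks.\<close>
  let ?B = "(\<lambda>f. {f} \<times> ends X f) ` (M `` {e})"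
  have "partition_on (nbhd \<Gamma> C) ?B"
  proof (rule partition_onI)
    show "{} \<notin> ?B"
    proof
      assume "{} \<in> ?B"
      then obtain f where f: "{} = {f} \<times> ends X f" "f \<in> M `` {e}"
        by (rule imageE)
      then have "ends X f = {}" by auto
      moreover have "f \<in> edges X" using f(2) class_subset by (rule subsetD[rotated])
      ultimately show False using ne by simp
    qed
  qed (auto simp: N disjnt_def)
  moreover have "?B \<noteq> {nbhd \<Gamma> C}"
  proof
    assume eq: "?B = {nbhd \<Gamma> C}"
    \<comment> \<open>If the whole neighbourhood were the only block, two distinct edges of the
      class would have the same darts.\<close>
    obtain f h where fh: "f \<in> M `` {e}" "h \<in> M `` {e}" "f \<noteq> h"
      using card card_le_Suc0_iff_eq[of "M `` {e}"] card_ge_0_finite[of "M `` {e}"] by fastforce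
    have block: "{f'} \<times> ends X f' = nbhd \<Gamma> C" if "f' \<in> M `` {e}" for f'
    proof -
      have "{f'} \<times> ends X f' \<in> ?B" using that by (rule imageI)
      then show ?thesis unfolding eq by (rule singletonD)
    qed
    have "f \<in> edges X" using fh(1) class_subset by (rule subsetD[rotated])
    then obtain x where "x \<in> ends X f" using ne by fastforce
    then have "(f, x) \<in> {h} \<times> ends X h"
      using block[OF fh(1)] block[OF fh(2)] by auto
    then show False using fh(3) by simp
  qed
  moreover have "?B \<noteq> (\<lambda>a. {a}) ` nbhd \<Gamma> C"
  proof
    assume eq: "?B = (\<lambda>a. {a}) ` nbhd \<Gamma> C"
    \<comment> \<open>The block over \<open>e\<close> has two elements because an edge has two
      endvertices, so it is not a singleton.\<close>
    have "{e} \<times> ends X e \<in> ?B"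
      using equiv_class_self[OF equiv e] by blast
    then obtain a where "{e} \<times> ends X e = {a}"
      using eq by auto
    then have "card ({e} \<times> ends X e) = 1"
      by simp
    then show False
      using graph e by (simp add: card_cartesian_product_singleton is_graph_def)
  qed
  moreover have "p ` B \<in> ?B" if "p \<in> local_group \<Gamma> (act ` G) C" "B \<in> ?B" for p B
  proof -
    obtain g where g: "g \<in> G" "vact (act g) C = C"
      and p: "p = (\<lambda>a. if a \<in> nbhd \<Gamma> C then eact (act g) a else a)"
      using \<open>p \<in> _\<close> by (auto simp: local_group_def vstab_def)
    obtain f where f: "(e, f) \<in> M" "B = {f} \<times> ends X f"
      using \<open>B \<in> _\<close> by auto
    then have fE: "f \<in> edges X"
      using class_subset by blast
    \<comment> \<open>\<open>B\<close> lies inside the neighbourhood, where \<open>p\<close> is the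
      action on darts. As \<open>g\<close> respects ends, it takes the darts over \<open>f\<close>
      to those over \<open>eact g f\<close>.\<close>
    have "p ` B = (\<lambda>(h, x). (eact g h, vact g x)) ` B"
      using f fE by (intro image_cong refl) (auto simp: p N eact_act darts_def)
    also have "\<dots> = {eact g f} \<times> ends X (eact g f)"
      using f fE symmetry_ends[OF symm[OF g(1)]] by auto
    finally have "p ` B = {eact g f} \<times> ends X (eact g f)" .
    \<comment> \<open>The image is again a block at \<open>C\<close> because \<open>g\<close> fixes
      the class \<open>C\<close> and hence keeps \<open>f\<close> inside it.\<close>
    moreover have "(e, eact g f) \<in> M"
    proof -
      have "Inr ` (M `` {eact g f}) = C"
        using image_class[OF g(1) fE] C_eq[OF f(1)] g(2) C by (simp add: vact_act)
      then have "M `` {eact g f} = M `` {e}"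
        by (simp add: C_def inj_image_eq_iff)
      then show ?thesis
        using eq_equiv_class[OF _ equiv symmetry_Inr(2)[OF symm[OF g(1)] fE]] by metis
    qed
    ultimately show ?thesis by blast
  qed
  ultimately have "partition_on (nbhd \<Gamma> C) ?B \<and> ?B \<noteq> {nbhd \<Gamma> C} \<and>
      ?B \<noteq> (\<lambda>x. {x}) ` nbhd \<Gamma> C \<and> (\<forall>p\<in>local_group \<Gamma> (act ` G) C. \<forall>B\<in>?B. p ` B \<in> ?B)"
    by (intro conjI ballI)
  then show "\<exists>\<B>. partition_on (nbhd \<Gamma> C) \<B> \<and> \<B> \<noteq> {nbhd \<Gamma> C} \<and>
      \<B> \<noteq> (\<lambda>x. {x}) ` nbhd \<Gamma> C \<and> (\<forall>p\<in>local_group \<Gamma> (act ` G) C. \<forall>B\<in>\<B>. p ` B \<in> \<B>)"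
    by (rule exI)
qed

end

text \<open>The first two conjuncts make precise that \<open>G\<close> itself acts on the quotient,
  faithfully. The imprimitivity claim is restricted to \<open>d \<ge> 2\<close>: for
  \<open>d = 1\<close> the neighbourhood of a white vertex has two points, and both partitions of
  such a set are trivial.\<close>

theorem theorem4p1:
  fixes X :: "('v, 'e) multigraph"
    and G :: "('v + 'e \<Rightarrow> 'v + 'e) set"
    and M :: "('e \<times> 'e) set"
    and k d :: nat
  assumes "is_graph X" and "valent k X"
    and "subgroup G (Aut X)" and "dart_transitive X G"
    and "separating X M" and "invariant_rel G M"
    and "\<forall>C\<in>edges X // M. card C = d"
  shows "bgcg_act X M \<in> hom ((Aut X)\<lparr>carrier := G\<rparr>) (Aut (BGCG X M)) \<and>
    inj_on (bgcg_act X M) G \<and>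
    simple_graph (BGCG X M) \<and>
    two_colored (BGCG X M) bgcg_color \<and>
    bi_transitive (BGCG X M) bgcg_color (bgcg_act X M ` G) \<and>
    (\<forall>v\<in>verts (BGCG X M). bgcg_color v = Black \<longrightarrow> valency (BGCG X M) v = k) \<and>
    (\<forall>v\<in>verts (BGCG X M). bgcg_color v = White \<longrightarrow> valency (BGCG X M) v = 2 * d) \<and>
    (d \<ge> 2 \<longrightarrow>
      (\<forall>v\<in>verts (BGCG X M). bgcg_color v = White \<longrightarrow>
        imprimitive (nbhd (BGCG X M) v) (local_group (BGCG X M) (bgcg_act X M ` G) v)))"
proof -
  interpret bgcg X G M
    using assms by (intro bgcg.intro)
  have d: "card (M `` {e}) = d" if "e \<in> edges X" for e
    using assms(7) that by (simp add: quotientI)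
  have black: "\<forall>v\<in>verts \<Gamma>. bgcg_color v = Black \<longrightarrow> valency \<Gamma> v = k"
    using \<open>valent k X\<close> by (auto simp: verts_BGCG valency_black valent_def)
  have white: "\<forall>v\<in>verts \<Gamma>. bgcg_color v = White \<longrightarrow> valency \<Gamma> v = 2 * d"
    by (auto simp: verts_BGCG valency_white d)
  have "\<forall>v\<in>verts \<Gamma>. bgcg_color v = White \<longrightarrow>
      imprimitive (nbhd \<Gamma> v) (local_group \<Gamma> (act ` G) v)" if "d \<ge> 2"
    using that by (auto simp: verts_BGCG d intro!: imprimitive_white[OF \<open>dart_transitive X G\<close>])
  then show ?thesis
    using act_hom act_inj simple_BGCG two_colored_BGCG black white
      bi_transitive_BGCG[OF \<open>dart_transitive X G\<close>] by blast
qed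

end
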